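(* Let $n,m\ge 1$, let $\tau_{i,j}\in\mathbb{R}_{\ge 0}$ for $i\in[n]$, $j\in[m]$, and let $b_i\in\mathbb{R}_{\ge 0}$ for $i\in[n]$. Consider the linear program in variables $\mathbf{z}=(z_{t,j})\in\mathbb{R}^{n\times m}$ and $\mathbf{r}\in\mathbb{R}^n$: $$\max\ \sum_{i=1}^n r_i\quad\text{s.t.}\quad r_i\le b_i\ (\forall i\in[n]),\quad r_i\le\sum_{j=1}^m\sum_{t=1}^n\tau_{t,j}\,\mathbb{1}(\tau_{t,j}\le\tau_{i,j})\,z_{t,j}\ (\forall i\in[n]),$$ $$\sum_{t=1}^n z_{t,j}=1\ (\forall j\in[m]),\qquad z_{t,j}\ge 0\ (\forall t\in[n],\,j\in[m]).$$ Let $(\mathbf{r},\mathbf{z})$ be an optimal basic feasible solution to this linear program. Then at most $m+n$ entries of $\mathbf{z}$ are positive.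
   Context: $\mathbb{1}(P)$ is 1 if the proposition $P$ is true and 0 otherwise; $[n]=\{1,\dots,n\}$. A basic feasible solution of a linear program in $N$ variables is a feasible point at which $N$ linearly independent constraints are tight (satisfied with equality). *)

theory Defs
  imports "HOL-Analysis.Analysis"
begin

datatype 'a lin_constraint = Leq 'a real | Geq 'a real | Eql 'a real

primrec satisfied :: "'a::euclidean_space lin_constraint \<Rightarrow> 'a \<Rightarrow> bool" where
  "satisfied (Leq a \<beta>) x \<longleftrightarrow> a \<bullet> x \<le> \<beta>"
| "satisfied (Geq a \<beta>) x \<longleftrightarrow> a \<bullet> x \<ge> \<beta>"
| "satisfied (Eql a \<beta>) x \<longleftrightarrow> a \<bullet> x = \<beta>"

primrec tight :: "'a::euclidean_space lin_constraint \<Rightarrow> 'a \<Rightarrow> bool" where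
  "tight (Leq a \<beta>) x \<longleftrightarrow> a \<bullet> x = \<beta>"
| "tight (Geq a \<beta>) x \<longleftrightarrow> a \<bullet> x = \<beta>"
| "tight (Eql a \<beta>) x \<longleftrightarrow> a \<bullet> x = \<beta>"

primrec normal_vec :: "'a lin_constraint \<Rightarrow> 'a" where
  "normal_vec (Leq a \<beta>) = a"
| "normal_vec (Geq a \<beta>) = a"
| "normal_vec (Eql a \<beta>) = a"

text \<open>Linear independence of constraints means linear independence of the family of their
  coefficient vectors; injectivity excludes two constraints sharing a coefficient vector,
  which \<^const>\<open>independent\<close>, applied to the image set, would not detect.\<close>

definition lin_indep_constraints :: "'a::euclidean_space lin_constraint set \<Rightarrow> bool" where
  "lin_indep_constraints S \<longleftrightarrow> inj_on normal_vec S \<and> independent (normal_vec ` S)"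

definition feasible :: "'a::euclidean_space lin_constraint set \<Rightarrow> 'a \<Rightarrow> bool" where
  "feasible C x \<longleftrightarrow> (\<forall>c\<in>C. satisfied c x)"

definition basic_feasible_solution :: "'a::euclidean_space lin_constraint set \<Rightarrow> 'a \<Rightarrow> bool" where
  "basic_feasible_solution C x \<longleftrightarrow>
     feasible C x \<and>
     (\<exists>S\<subseteq>C. card S = DIM('a) \<and> lin_indep_constraints S \<and> (\<forall>c\<in>S. tight c x))"

definition optimal_solution ::
    "('a::euclidean_space \<Rightarrow> real) \<Rightarrow> 'a lin_constraint set \<Rightarrow> 'a \<Rightarrow> bool" where
  "optimal_solution f C x \<longleftrightarrow> feasible C x \<and> (\<forall>y. feasible C y \<longrightarrow> f y \<le> f x)"

text \<open>The variables are pairs \<open>(r, z)\<close>, where \<open>z $ t $ j\<close> is the entry in row \<open>t\<close> and column \<open>j\<close>.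
  In the second family below, the variables on the right-hand side of the inequality
  have been moved to the left; see \<open>feasible_lp_constraints_iff\<close>.\<close>

definition lp_constraints ::
    "('n::finite \<Rightarrow> 'm::finite \<Rightarrow> real) \<Rightarrow> ('n \<Rightarrow> real) \<Rightarrow> ((real ^ 'n) \<times> (real ^ 'm ^ 'n)) lin_constraint set" where
  "lp_constraints \<tau> b =
     range (\<lambda>i. Leq (axis i 1, 0) (b i))
   \<union> range (\<lambda>i. Leq (axis i 1, - (\<chi> t j. \<tau> t j * of_bool (\<tau> t j \<le> \<tau> i j))) 0)
   \<union> range (\<lambda>j. Eql (0, \<chi> t. axis j 1) 1)
   \<union> range (\<lambda>(t, j). Geq (0, axis t (axis j 1)) 0)"

definition lp_objective :: "(real ^ 'n::finite) \<times> (real ^ 'm::finite ^ 'n) \<Rightarrow> real" where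
  "lp_objective = (\<lambda>(r, z). \<Sum>i\<in>UNIV. r $ i)"

lemma feasible_lp_constraints_iff:
  fixes \<tau> :: "'n::finite \<Rightarrow> 'm::finite \<Rightarrow> real"
  shows "feasible (lp_constraints \<tau> b) (r, z) \<longleftrightarrow>
    (\<forall>i. r $ i \<le> b i) \<and>
    (\<forall>i. r $ i \<le> (\<Sum>j\<in>UNIV. \<Sum>t\<in>UNIV. \<tau> t j * of_bool (\<tau> t j \<le> \<tau> i j) * z $ t $ j)) \<and>
    (\<forall>j. (\<Sum>t\<in>UNIV. z $ t $ j) = 1) \<and>
    (\<forall>t j. z $ t $ j \<ge> 0)"
proof -
  have *: "(\<chi> t j. f t j) \<bullet> z = (\<Sum>j\<in>UNIV. \<Sum>t\<in>UNIV. f t j * z $ t $ j)"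
    for f :: "'n \<Rightarrow> 'm \<Rightarrow> real"
    by (simp add: inner_vec_def) (rule sum.swap)
  have **: "(\<chi> t. axis j (1::real)) \<bullet> z = (\<Sum>t\<in>UNIV. z $ t $ j)" for j
    by (simp add: inner_vec_def[of _ z] inner_axis')
  show ?thesis
    unfolding feasible_def lp_constraints_def
    by (simp add: ball_Un * ** inner_axis' conj_assoc)
qed

lemma lp_dimension:
  "DIM((real ^ 'n::finite) \<times> (real ^ 'm::finite ^ 'n)) = CARD('n) * CARD('m) + CARD('n)"
  by simp

end

theory Submission imports Defs begin

text \<open>The argument counts tight constraints. With n = \<open>CARD('n)\<close> and m =
  \<open>CARD('m)\<close>, a basic feasible solution has nm + n distinct tight constraints. Only 2n
  + m constraints are not sign constraints on \<open>z\<close>: two upper bounds for each entry of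
  \<open>r\<close> and one equation per column of \<open>z\<close>. So at least nm - n - m sign
  constraints are tight, each forcing its own entry of \<open>z\<close> to vanish, which leaves at
  most n + m positive entries.\<close>

theorem theorem4:
  fixes \<tau> :: "'n::finite \<Rightarrow> 'm::finite \<Rightarrow> real"
    and b :: "'n \<Rightarrow> real"
    and r :: "real ^ 'n"
    and z :: "real ^ 'm ^ 'n"
  assumes "\<And>i j. \<tau> i j \<ge> 0"
    and "\<And>i. b i \<ge> 0"
    and "basic_feasible_solution (lp_constraints \<tau> b) (r, z)"
    and "optimal_solution lp_objective (lp_constraints \<tau> b) (r, z)"
  shows "card {(t, j). z $ t $ j > 0} \<le> CARD('m) + CARD('n)"
proof -
  obtain S where S: "S \<subseteq> lp_constraints \<tau> b"
    and card_S: "card S = CARD('n) * CARD('m) + CARD('n)"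
    and tight_S: "\<And>c. c \<in> S \<Longrightarrow> tight c (r, z)"
    using assms(3) unfolding basic_feasible_solution_def lp_dimension by blast
  define nonneg :: "'n \<times> 'm \<Rightarrow> ((real ^ 'n) \<times> (real ^ 'm ^ 'n)) lin_constraint"
    where "nonneg = (\<lambda>(t, j). Geq (0, axis t (axis j 1)) 0)"
  define A where "A = range (\<lambda>i. Leq (axis i (1 :: real), 0 :: real ^ 'm ^ 'n) (b i))"
  define B where "B = range (\<lambda>i. Leq (axis i (1 :: real),
    - (\<chi> t j. \<tau> t j * of_bool (\<tau> t j \<le> \<tau> i j))) 0)"
  define E where
    "E = range (\<lambda>j. Eql (0 :: real ^ 'n, \<chi> t :: 'n. axis (j :: 'm) (1 :: real)) 1)"
  define P where "P = {(t, j). z $ t $ j > 0}"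
  define Z where "Z = {(t, j). z $ t $ j = 0}"
  have lp_constraints_eq: "lp_constraints \<tau> b = A \<union> B \<union> E \<union> range nonneg"
    unfolding lp_constraints_def A_def B_def E_def nonneg_def ..
  \<comment> \<open>Tightness enters here: a sign constraint in \<open>S\<close> holds with
    equality, so its index pair lies in \<open>Z\<close>.\<close>
  have "S \<subseteq> A \<union> B \<union> E \<union> nonneg ` Z"
  proof
    fix c assume c: "c \<in> S"
    with S consider "c \<in> A \<union> B \<union> E" | t j where "c = nonneg (t, j)"
      unfolding lp_constraints_eq by auto
    then show "c \<in> A \<union> B \<union> E \<union> nonneg ` Z"
    proof cases
      case 2
      with tight_S[OF c] have "(t, j) \<in> Z"
        by (simp add: nonneg_def Z_def inner_axis')
      with 2 show ?thesis by blast
    qed blast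
  qed
  then have "card S \<le> card (A \<union> B \<union> E \<union> nonneg ` Z)"
    by (rule card_mono[rotated]) (simp add: A_def B_def E_def)
  also have "\<dots> \<le> card A + card B + card E + card (nonneg ` Z)"
    by (meson add_le_mono card_Un_le le_trans order_refl)
  \<comment> \<open>Each family is an image of its index set, so coinciding constraints could only
    lower the count.\<close>
  also have "\<dots> \<le> CARD('n) + CARD('n) + CARD('m) + card Z"
    unfolding A_def B_def E_def by (intro add_mono card_image_le) simp_all
  \<comment> \<open>One n cancels against \<open>card_S\<close>. The additive form avoids truncated
    subtraction, as nm may be below n + m.\<close>
  finally have "CARD('n) * CARD('m) \<le> CARD('n) + CARD('m) + card Z"
    using card_S by simp
  moreover have "card P + card Z \<le> CARD('n) * CARD('m)"
  proof -
    have "card P + card Z = card (P \<union> Z)"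
      by (rule card_Un_disjoint[symmetric]) (auto simp: P_def Z_def)
    also have "\<dots> \<le> CARD('n \<times> 'm)" by (rule card_mono) simp_all
    finally show ?thesis by simp
  qed
  ultimately show ?thesis unfolding P_def by linarith
qed

end
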